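(* Let $N\in\mathbb N$, let $\mathcal H_{\mathbb R}$ be a real Hilbert space, $\alpha\in S_0(n)$, $h_1,\dots,h_n\in\mathcal H_{\mathbb R}$, and $1\le\ell,r\le N$. Then $$H_\alpha(X(h_1),\dots,X(h_n))_{\ell r}=\sum_{\substack{\mathbf u\in[N]^{[0,n]} \\ {} u(0)=r,\ u(\alpha(0))=\ell}}W\Big(\bigotimes_{i=1}^n\big(E_{u(i),u(\alpha(i))}\otimes h_i\big)\Big),$$ where $E_{ij}$ are the matrix units of $M_N(\mathbb C)$. That is, the matrix entries of the Hermite trace polynomial over $\mathcal H_{\mathbb R}$ are (sums of) multivariate Hermite polynomials over $M_N(\mathbb C)\otimes\mathcal H_{\mathbb R}$.
   Context: $[n]=\{1,\dots,n\}$, $[0,n]=\{0,\dots,n\}$; $S_0(n)$ is the permutation group of $[0,n]$, products composed right to left. $\mathrm{cyc}_0(\alpha)$ is the number of cycles of $\alpha\in S_0(n)$ (fixed points are cycles) not containing $0$. Gaussian side. Let $\mathcal K_{\mathbb R}=M_N^{sa}(\mathbb C)\otimes\mathcal H_{\mathbb R}$ and $\mathcal K=M_N(\mathbb C)\otimes\mathcal H_{\mathbb R}$ its complexification, with inner product $\langle A\otimes f,B\otimes g\rangle=\frac1N\mathrm{Tr}[AB^*]\langle f,g\rangle$ and conjugation $\overline{A\otimes f}=A^*\otimes f$. Let $\{X(k):k\in\mathcal K\}$ be the complexified Gaussian Hilbert space: $X$ is complex linear, $\{X(k):k\in\mathcal K_{\mathbb R}\}$ are real jointly Gaussian centered, and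 $\mathbb E[X(k)X(k')]=\langle k,\overline{k'}\rangle$. For $h\in\mathcal H_{\mathbb R}$, $X(h)$ is the $N\times N$ Hermitian random matrix with entries $X(h)_{ij}=X(E_{ij}\otimes h)$, so that $\mathbb E[X(f)_{ij}X(g)_{k\ell}]=\frac1N\delta_{i=\ell}\delta_{j=k}\langle f,g\rangle$. For $k_1,\dots,k_n\in\mathcal K$ the multivariate Hermite polynomial (Wick product) is $$W(k_1\otimes\dots\otimes k_n)=\sum_{\pi\in\mathcal P_{1,2}(n)}(-1)^{|\pi|}\prod_{\{i,j\}\text{ pair of }\pi}\langle k_i,\overline{k_j}\rangle\prod_{m\text{ singleton of }\pi}X(k_m).$$ Trace polynomial side ($q=1/N$). $\mathcal P_{1,2}(n)$ is the set of partitions $\pi$ of $[n]$ into blocks of size 1 and 2, identified with the involution swapping the elements of each pair; $|\pi|$ is the number of pairs, $\mathrm{supp}(\pi)$ their union. For $S\subset[n]$, $\alpha|_{S^c}$ is the permutation of $[0,n]\setminus S$, $x\mapsto\alpha^m(x)$, $m=\min\{j>0:\alpha^j(x)\notin S\}$. With $p=|\pi|$, $$C_\pi(\alpha)=q^{\mathrm{cyc}_0((\pi\alpha)|_{\mathrm{supp}(\pi)^c})-\mathrm{cyc}_0(\pi\alpha)+p}\,P\big((\pi\alpha)|_{\mathrm{supp}(\pi)^c}\big)\in\mathbb C[S_0(n-2p)],$$ $P$ relabelling $[0,n]\setminus\mathrm{supp}(\pi)$ by $[0,n-2p]$ order-preservingly. For matrices, $\mathrm{Tr}_\alpha(A_1,\dots,A_n)=A_{\alpha(0)}A_{\alpha^2(0)}\cdots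 A_{\alpha^{-1}(0)}\prod_{\text{other cycles }(i_1\dots i_m)}\mathrm{Tr}[A_{i_1}\cdots A_{i_m}]$ (un-normalized trace; first product is $I_N$ if $\alpha(0)=0$), extended linearly to $\mathbb C[S_0(n)]$. The $\alpha$-Hermite trace polynomial is the random matrix $$H_\alpha(X(h_1),\dots,X(h_n))=\sum_{\pi\in\mathcal P_{1,2}(n)}(-1)^{|\pi|}\prod_{\{i,j\}\text{ pair of }\pi}\langle h_i,h_j\rangle\ \mathrm{Tr}_{C_\pi(\alpha)}\big(X(h_{u_1}),\dots,X(h_{u_{n-2|\pi|}})\big),$$ $u_1<\dots<u_{n-2|\pi|}$ being the singletons of $\pi$. *)

theory Defs
  imports
    "HOL-Probability.Probability"
    "HOL-Combinatorics.Orbits"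
    "HOL-Library.Poly_Mapping"
begin

section \<open>Matrices\<close>

definition matrix_unit :: "'n \<Rightarrow> 'n \<Rightarrow> complex^'n^'n::finite" where
  "matrix_unit a b = (\<chi> i j. if i = a \<and> j = b then 1 else 0)"

definition mat_adjoint :: "complex^'n^'n \<Rightarrow> complex^'n^'n::finite" where
  "mat_adjoint A = (\<chi> i j. cnj (A $ j $ i))"

definition mat_scale :: "complex \<Rightarrow> complex^'n^'n \<Rightarrow> complex^'n^'n::finite" where
  "mat_scale c A = (\<chi> i j. c * A $ i $ j)"

text \<open>The ordered product of a list of matrices; the empty product is the identity.\<close>

definition mat_prod_list :: "(complex^'n^'n) list \<Rightarrow> complex^'n^'n::finite" where
  "mat_prod_list As = foldr (**) As (mat 1)"


section \<open>The space of matrices tensored with a real Hilbert space\<close>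

text \<open>
  The real tensor product of the \<open>N \<times> N\<close> complex matrices with a real Hilbert space \<open>'h\<close> is
  realised as the space of \<open>N \<times> N\<close> matrices with entries in the complexification of \<open>'h\<close>.
  A pair \<open>(f, g) :: 'h \<times> 'h\<close> stands for the element \<open>f + \<i> g\<close> of that complexification.
\<close>

type_synonym ('h, 'n) mtensor = "(('h \<times> 'h)^'n)^'n"

definition cscale :: "complex \<Rightarrow> 'h \<times> 'h \<Rightarrow> 'h \<times> 'h::real_vector" where
  "cscale c v = (Re c *\<^sub>R fst v - Im c *\<^sub>R snd v, Re c *\<^sub>R snd v + Im c *\<^sub>R fst v)"

text \<open>The inner product is linear in the first and conjugate linear in the second argument.\<close>

definition cinner :: "'h \<times> 'h \<Rightarrow> 'h \<times> 'h::real_inner \<Rightarrow> complex" where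
  "cinner v w = Complex (fst v \<bullet> fst w + snd v \<bullet> snd w) (snd v \<bullet> fst w - fst v \<bullet> snd w)"

definition mtensor_scale ::
    "complex \<Rightarrow> ('h::real_vector, 'n::finite) mtensor \<Rightarrow> ('h, 'n) mtensor" where
  "mtensor_scale c k = (\<chi> i j. cscale c (k $ i $ j))"

definition mtensor_inner ::
    "('h::real_inner, 'n::finite) mtensor \<Rightarrow> ('h, 'n) mtensor \<Rightarrow> complex" where
  "mtensor_inner k k' = (\<Sum>i\<in>UNIV. \<Sum>j\<in>UNIV. cinner (k $ i $ j) (k' $ i $ j)) / of_nat CARD('n)"

definition mtensor_conj ::
    "('h::real_vector, 'n::finite) mtensor \<Rightarrow> ('h, 'n) mtensor" where
  "mtensor_conj k = (\<chi> i j. (fst (k $ j $ i), - snd (k $ j $ i)))"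

definition elem_tensor ::
    "complex^'n^'n \<Rightarrow> 'h \<Rightarrow> ('h::real_vector, 'n::finite) mtensor" where
  "elem_tensor A f = (\<chi> i j. (Re (A $ i $ j) *\<^sub>R f, Im (A $ i $ j) *\<^sub>R f))"

definition mtensor_real :: "('h::real_vector, 'n::finite) mtensor set" where
  "mtensor_real = span {elem_tensor A f | A f. mat_adjoint A = A}"

lemma elem_tensor_add_left: "elem_tensor (A + B) f = elem_tensor A f + elem_tensor B f"
  by (simp add: elem_tensor_def vec_eq_iff scaleR_left_distrib)

lemma elem_tensor_add_right: "elem_tensor A (f + g) = elem_tensor A f + elem_tensor A g"
  by (simp add: elem_tensor_def vec_eq_iff scaleR_right_distrib)

lemma elem_tensor_scaleR_right: "elem_tensor A (r *\<^sub>R f) = r *\<^sub>R elem_tensor A f"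
  by (simp add: elem_tensor_def vec_eq_iff mult.commute)

lemma elem_tensor_mat_scale: "elem_tensor (mat_scale c A) f = mtensor_scale c (elem_tensor A f)"
  by (simp add: elem_tensor_def mat_scale_def mtensor_scale_def cscale_def vec_eq_iff
      scaleR_left_distrib scaleR_left_diff_distrib)

lemma mtensor_inner_elem_tensor:
  "mtensor_inner (elem_tensor A f) (elem_tensor (B :: complex^'n::finite^'n) g) =
     trace (A ** mat_adjoint B) / of_nat CARD('n) * complex_of_real (f \<bullet> g)"
proof -
  have *: "cinner (Re a *\<^sub>R f, Im a *\<^sub>R f) (Re b *\<^sub>R g, Im b *\<^sub>R g) = a * cnj b * complex_of_real (f \<bullet> g)"
    for a b by (simp add: cinner_def complex_eq_iff algebra_simps)
  show ?thesis
    by (simp add: mtensor_inner_def elem_tensor_def trace_def matrix_matrix_mult_def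
        mat_adjoint_def * sum_distrib_right)
qed

lemma mtensor_conj_elem_tensor: "mtensor_conj (elem_tensor A f) = elem_tensor (mat_adjoint A) f"
  by (simp add: mtensor_conj_def elem_tensor_def mat_adjoint_def vec_eq_iff)

lemma mtensor_decomp:
  "k = (\<Sum>a\<in>UNIV. \<Sum>b\<in>UNIV. elem_tensor (matrix_unit a b) (fst (k $ a $ b)) +
         mtensor_scale \<i> (elem_tensor (matrix_unit a b) (snd (k $ a $ b))))"
proof -
  have *: "(elem_tensor (matrix_unit a b) f + mtensor_scale \<i> (elem_tensor (matrix_unit a b) g)) $ i $ j
        = (if b = j then if a = i then (f, g) else 0 else 0)" for a b i j :: 'b and f g :: 'a
    by (auto simp: elem_tensor_def matrix_unit_def mtensor_scale_def cscale_def zero_prod_def)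
  show ?thesis
    by (simp add: vec_eq_iff sum_component * sum.delta del: vector_add_component)
qed


section \<open>The complexified Gaussian Hilbert space\<close>

text \<open>The point mass at \<open>0\<close> counts as a centered Gaussian distribution.\<close>

definition centered_gaussian :: "'w measure \<Rightarrow> ('w \<Rightarrow> real) \<Rightarrow> bool" where
  "centered_gaussian M Y \<longleftrightarrow> Y \<in> borel_measurable M \<and>
     ((AE \<omega> in M. Y \<omega> = 0) \<or> (\<exists>\<sigma>>0. distributed M lborel Y (normal_density 0 \<sigma>)))"

definition jointly_centered_gaussian :: "'w measure \<Rightarrow> 'k set \<Rightarrow> ('k \<Rightarrow> 'w \<Rightarrow> real) \<Rightarrow> bool" where
  "jointly_centered_gaussian M I Y \<longleftrightarrow>
     (\<forall>F c. finite F \<longrightarrow> F \<subseteq> I \<longrightarrow> centered_gaussian M (\<lambda>\<omega>. \<Sum>k\<in>F. c k * Y k \<omega>))"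

text \<open>
  The random variables \<open>X k\<close> are given by representatives, so that linearity and reality are
  required to hold almost surely.
\<close>

definition complexified_gaussian ::
    "'w measure \<Rightarrow> (('h::{real_inner,complete_space}, 'n::finite) mtensor \<Rightarrow> 'w \<Rightarrow> complex) \<Rightarrow> bool" where
  "complexified_gaussian M X \<longleftrightarrow>
     prob_space M \<and>
     (\<forall>k. X k \<in> borel_measurable M) \<and>
     (\<forall>k k'. AE \<omega> in M. X (k + k') \<omega> = X k \<omega> + X k' \<omega>) \<and>
     (\<forall>c k. AE \<omega> in M. X (mtensor_scale c k) \<omega> = c * X k \<omega>) \<and>
     (\<forall>k\<in>mtensor_real. AE \<omega> in M. X k \<omega> \<in> \<real>) \<and>
     jointly_centered_gaussian M mtensor_real (\<lambda>k \<omega>. Re (X k \<omega>)) \<and>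
     (\<forall>k k'. (\<integral>\<omega>. X k \<omega> * X k' \<omega> \<partial>M) = mtensor_inner k (mtensor_conj k'))"

definition gaussian_matrix ::
    "(('h::real_vector, 'n::finite) mtensor \<Rightarrow> 'w \<Rightarrow> complex) \<Rightarrow> 'h \<Rightarrow> 'w \<Rightarrow> complex^'n^'n" where
  "gaussian_matrix X h \<omega> = (\<chi> i j. X (elem_tensor (matrix_unit i j) h) \<omega>)"


section \<open>Partitions into pairs and singletons\<close>

definition partitions12 :: "nat \<Rightarrow> nat set set set" where
  "partitions12 n = {\<pi>. partition_on {1..n} \<pi> \<and> (\<forall>B\<in>\<pi>. card B \<in> {1, 2})}"

definition pairs :: "nat set set \<Rightarrow> nat set set" where
  "pairs \<pi> = {B \<in> \<pi>. card B = 2}"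

definition pair_supp :: "nat set set \<Rightarrow> nat set" where
  "pair_supp \<pi> = \<Union> (pairs \<pi>)"

definition involution :: "nat set set \<Rightarrow> nat \<Rightarrow> nat" where
  "involution \<pi> x = (if x \<in> pair_supp \<pi> then THE y. y \<noteq> x \<and> {x, y} \<in> \<pi> else x)"


section \<open>Wick products\<close>

text \<open>
  The value at \<open>k\<^sub>1 \<otimes> \<dots> \<otimes> k\<^sub>n\<close>. The form \<open>\<langle>k, \<close>conj\<open> k'\<rangle>\<close> is symmetric, so that the order
  in which the two elements of a pair are taken is immaterial.
\<close>

definition wick ::
    "(('h::real_inner, 'n::finite) mtensor \<Rightarrow> 'w \<Rightarrow> complex) \<Rightarrow> nat \<Rightarrow>
     (nat \<Rightarrow> ('h, 'n) mtensor) \<Rightarrow> 'w \<Rightarrow> complex" where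
  "wick X n k \<omega> = (\<Sum>\<pi>\<in>partitions12 n. (- 1) ^ card (pairs \<pi>) *
     (\<Prod>B\<in>pairs \<pi>. mtensor_inner (k (Min B)) (mtensor_conj (k (Max B)))) *
     (\<Prod>m\<in>{1..n} - pair_supp \<pi>. X (k m) \<omega>))"


section \<open>Permutations and their restrictions\<close>

text \<open>
  Permutations of a finite set \<open>A\<close> of naturals are functions that are the identity off \<open>A\<close>;
  the set \<open>A\<close> has to be given to count fixed points as cycles.
\<close>

definition cycles0 :: "nat set \<Rightarrow> (nat \<Rightarrow> nat) \<Rightarrow> nat set set" where
  "cycles0 A \<sigma> = {C \<in> orbit \<sigma> ` A. 0 \<notin> C}"

definition cyc0 :: "nat set \<Rightarrow> (nat \<Rightarrow> nat) \<Rightarrow> nat" where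
  "cyc0 A \<sigma> = card (cycles0 A \<sigma>)"

definition skip_perm :: "(nat \<Rightarrow> nat) \<Rightarrow> nat set \<Rightarrow> nat \<Rightarrow> nat" where
  "skip_perm \<sigma> S x = (if x \<in> S then x else (\<sigma> ^^ (LEAST m. 0 < m \<and> (\<sigma> ^^ m) x \<notin> S)) x)"

text \<open>
  Transport of a permutation of \<open>A\<close> to \<open>{0..<card A}\<close> along the order isomorphism
  \<open>i \<mapsto> sorted_list_of_set A ! i\<close>.
\<close>

definition relabel :: "nat set \<Rightarrow> (nat \<Rightarrow> nat) \<Rightarrow> nat \<Rightarrow> nat" where
  "relabel A \<sigma> i = (if i < card A then card {y \<in> A. y < \<sigma> (sorted_list_of_set A ! i)} else i)"


section \<open>Trace polynomials\<close>

definition tr_perm ::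
    "nat \<Rightarrow> (nat \<Rightarrow> nat) \<Rightarrow> (nat \<Rightarrow> complex^'n^'n) \<Rightarrow> complex^'n^'n::finite" where
  "tr_perm n \<sigma> A =
     mat_scale
       (\<Prod>C\<in>cycles0 {0..n} \<sigma>.
          trace (mat_prod_list (map (\<lambda>j. A ((\<sigma> ^^ j) (Min C))) [0..<card C])))
       (mat_prod_list (map (\<lambda>j. A ((\<sigma> ^^ j) 0)) [1..<card (orbit \<sigma> 0)]))"

text \<open>Elements of the group algebra are finitely supported complex functions.\<close>

definition tr_alg ::
    "nat \<Rightarrow> ((nat \<Rightarrow> nat) \<Rightarrow>\<^sub>0 complex) \<Rightarrow> (nat \<Rightarrow> complex^'n^'n) \<Rightarrow> complex^'n^'n::finite" where
  "tr_alg n \<xi> A = (\<Sum>\<sigma>\<in>Poly_Mapping.keys \<xi>. mat_scale (Poly_Mapping.lookup \<xi> \<sigma>) (tr_perm n \<sigma> A))"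

definition contraction ::
    "complex \<Rightarrow> nat \<Rightarrow> nat set set \<Rightarrow> (nat \<Rightarrow> nat) \<Rightarrow> (nat \<Rightarrow> nat) \<Rightarrow>\<^sub>0 complex" where
  "contraction q n \<pi> \<alpha> =
     (let A = {0..n} - pair_supp \<pi>;
          \<beta> = involution \<pi> \<circ> \<alpha>;
          \<gamma> = skip_perm \<beta> (pair_supp \<pi>)
      in Poly_Mapping.single (relabel A \<gamma>)
           (q powi (int (cyc0 A \<gamma>) - int (cyc0 {0..n} \<beta>) + int (card (pairs \<pi>)))))"

definition hermite_trace ::
    "(('h::real_inner, 'n::finite) mtensor \<Rightarrow> 'w \<Rightarrow> complex) \<Rightarrow> nat \<Rightarrow> (nat \<Rightarrow> nat) \<Rightarrow>
     (nat \<Rightarrow> 'h) \<Rightarrow> 'w \<Rightarrow> complex^'n^'n" where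
  "hermite_trace X n \<alpha> h \<omega> = (\<Sum>\<pi>\<in>partitions12 n.
     mat_scale ((- 1) ^ card (pairs \<pi>) * (\<Prod>B\<in>pairs \<pi>. complex_of_real (h (Min B) \<bullet> h (Max B))))
       (tr_alg (n - 2 * card (pairs \<pi>)) (contraction (1 / of_nat CARD('n)) n \<pi> \<alpha>)
          (\<lambda>i. gaussian_matrix X (h (sorted_list_of_set ({1..n} - pair_supp \<pi>) ! (i - 1))) \<omega>)))"

end

theory Submission
  imports Defs
begin

text \<open>
  Both sides are sums over the partitions \<open>\<pi>\<close> into pairs and singletons, with the same signs, and
  they agree for each \<open>\<pi>\<close> separately and pointwise in \<open>\<omega>\<close>. Fix \<open>\<pi>\<close>, let \<open>S\<close> be the union of its pairs,
  \<open>\<beta> = involution \<pi> \<circ> \<alpha>\<close>, \<open>N = CARD('n)\<close> and \<open>p\<close> the number of pairs.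

  The common language is the \<open>state_sum\<close>: a sum over labellings \<open>u\<close> of the points by matrix indices of
  the product of the entries \<open>(u i, u (\<sigma> i))\<close> of matrices \<open>B i\<close>. Expanding matrix products and traces
  shows that an entry of a trace monomial is a state sum (\<open>tr_perm_entry\<close>).

  On the Wick side, apart from the inner products of the \<open>h i\<close>, which both sides share, the
  covariance of two matrix units is \<open>1 / N\<close> or zero, so that the pairs of \<open>\<pi>\<close> produce
  \<open>1 / N ^ p\<close> and restrict the labellings. After a change of variables the restriction is that
  \<open>u\<close> is preserved by \<open>\<beta>\<close> at the points of \<open>S\<close>. Such a labelling may be propagated backwards from the
  points outside \<open>S\<close>, which replaces \<open>\<beta>\<close> by \<open>skip_perm \<beta> S\<close>, and it has one additional free label
  for each cycle of \<open>\<beta>\<close> contained in \<open>S\<close> (\<open>state_sum_skip_perm\<close>, \<open>wick_term_sum\<close>).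

  On the trace side the contraction has the same permutation \<open>skip_perm \<beta> S\<close>. Skipping \<open>S\<close> destroys
  precisely the cycles contained in \<open>S\<close> (\<open>cyc0_skip_perm\<close>), so its weight is \<open>N\<close> to the number of these
  cycles divided by \<open>N ^ p\<close>, as on the Wick side (\<open>contraction_entry\<close>).
\<close>


section \<open>State sums\<close>

text \<open>
  A partition function on the functional graph of \<open>\<sigma>\<close>: the points of \<open>A\<close> carry labels, and the
  matrix \<open>B i\<close> is the weight of the edge from \<open>i\<close> to \<open>\<sigma> i\<close>.
\<close>

definition state_sum :: "'a set \<Rightarrow> ('a \<Rightarrow> 'a) \<Rightarrow> ('a \<Rightarrow> complex^'n^'n::finite) \<Rightarrow> complex" where
  "state_sum A \<sigma> B = (\<Sum>u\<in>A \<rightarrow>\<^sub>E UNIV. \<Prod>i\<in>A. B i $ u i $ u (\<sigma> i))"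

lemma state_sum_cong:
  assumes "\<And>i. i \<in> A \<Longrightarrow> \<sigma> i = \<sigma>' i" "\<And>i. i \<in> A \<Longrightarrow> B i = B' i"
  shows "state_sum A \<sigma> B = state_sum A \<sigma>' B'"
  unfolding state_sum_def using assms by (intro sum.cong prod.cong) auto

lemma state_sum_reindex:
  assumes e: "bij_betw e A A'" and \<sigma>: "\<And>i. i \<in> A \<Longrightarrow> \<sigma> i \<in> A"
    and eq: "\<And>i. i \<in> A \<Longrightarrow> \<sigma>' (e i) = e (\<sigma> i)"
  shows "state_sum A' \<sigma>' B = state_sum A \<sigma> (B \<circ> e)"
proof -
  have inj: "inj_on e A" and img: "e ` A = A'" using e by (auto simp: bij_betw_def)
  have inv: "inv_into A e x \<in> A" "e (inv_into A e x) = x" if "x \<in> A'" for x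
    using that img by (auto simp: inv_into_into f_inv_into_f)
  show ?thesis
    unfolding state_sum_def
  proof (rule sum.reindex_bij_witness[where
        i = "\<lambda>w. restrict (w \<circ> inv_into A e) A'" and j = "\<lambda>u. restrict (u \<circ> e) A"])
    fix u :: "'b \<Rightarrow> 'c" assume u: "u \<in> A' \<rightarrow>\<^sub>E UNIV"
    show "restrict (restrict (u \<circ> e) A \<circ> inv_into A e) A' = u"
      using u inv by (auto simp: fun_eq_iff PiE_def extensional_def)
    have "(\<Prod>i\<in>A'. B i $ u i $ u (\<sigma>' i)) = (\<Prod>i\<in>A. B (e i) $ u (e i) $ u (\<sigma>' (e i)))"
      by (rule prod.reindex_bij_betw[OF e, symmetric])
    also have "\<dots> = (\<Prod>i\<in>A. (B \<circ> e) i $ restrict (u \<circ> e) A i $ restrict (u \<circ> e) A (\<sigma> i))"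
      by (rule prod.cong) (simp_all add: eq \<sigma>)
    finally show "(\<Prod>i\<in>A. (B \<circ> e) i $ restrict (u \<circ> e) A i $ restrict (u \<circ> e) A (\<sigma> i)) =
        (\<Prod>i\<in>A'. B i $ u i $ u (\<sigma>' i))" by simp
  next
    fix w :: "'a \<Rightarrow> 'c" assume w: "w \<in> A \<rightarrow>\<^sub>E UNIV"
    show "restrict (restrict (w \<circ> inv_into A e) A' \<circ> e) A = w"
      using w inj img by (auto simp: fun_eq_iff PiE_def extensional_def)
  qed auto
qed

lemma state_sum_Un:
  assumes "A1 \<inter> A2 = {}" "finite A1" "finite A2"
    and "\<And>i. i \<in> A1 \<Longrightarrow> \<sigma> i \<in> A1" "\<And>i. i \<in> A2 \<Longrightarrow> \<sigma> i \<in> A2"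
  shows "state_sum (A1 \<union> A2) \<sigma> B = state_sum A1 \<sigma> B * state_sum A2 \<sigma> B"
proof -
  have "state_sum A1 \<sigma> B * state_sum A2 \<sigma> B =
      (\<Sum>(u, v)\<in>(A1 \<rightarrow>\<^sub>E UNIV) \<times> (A2 \<rightarrow>\<^sub>E UNIV).
         (\<Prod>i\<in>A1. B i $ u i $ u (\<sigma> i)) * (\<Prod>i\<in>A2. B i $ v i $ v (\<sigma> i)))"
    by (simp add: state_sum_def sum_product sum.cartesian_product)
  also have "\<dots> = state_sum (A1 \<union> A2) \<sigma> B"
    unfolding state_sum_def
  proof (rule sum.reindex_bij_witness[where
        j = "\<lambda>(u, v). \<lambda>i\<in>A1 \<union> A2. if i \<in> A1 then u i else v i"
        and i = "\<lambda>w. (restrict w A1, restrict w A2)"], goal_cases)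
    case (1 a) then show ?case using assms(1)
      by (auto simp: fun_eq_iff PiE_def extensional_def restrict_def split: if_splits)
  next
    case (3 w) then show ?case
      by (auto simp: fun_eq_iff PiE_def extensional_def restrict_def)
  next
    case (5 a)
    obtain u v where a: "a = (u, v)" by force
    let ?w = "\<lambda>i\<in>A1 \<union> A2. if i \<in> A1 then u i else v i"
    have "(\<Prod>i\<in>A1 \<union> A2. B i $ ?w i $ ?w (\<sigma> i)) =
        (\<Prod>i\<in>A1. B i $ ?w i $ ?w (\<sigma> i)) * (\<Prod>i\<in>A2. B i $ ?w i $ ?w (\<sigma> i))"
      using assms by (intro prod.union_disjoint) auto
    also have "(\<Prod>i\<in>A1. B i $ ?w i $ ?w (\<sigma> i)) = (\<Prod>i\<in>A1. B i $ u i $ u (\<sigma> i))"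
      using assms by (intro prod.cong) auto
    also have "(\<Prod>i\<in>A2. B i $ ?w i $ ?w (\<sigma> i)) = (\<Prod>i\<in>A2. B i $ v i $ v (\<sigma> i))"
    proof (rule prod.cong)
      fix i assume "i \<in> A2"
      then have "i \<notin> A1" "\<sigma> i \<in> A2" "\<sigma> i \<notin> A1" using assms(1,5) by auto
      then show "B i $ ?w i $ ?w (\<sigma> i) = B i $ v i $ v (\<sigma> i)"
        using \<open>i \<in> A2\<close> by simp
    qed simp
    finally show ?case by (simp add: a)
  qed auto
  finally show ?thesis by simp
qed

lemma state_sum_Union:
  assumes "finite \<C>" "\<And>C. C \<in> \<C> \<Longrightarrow> finite C" "\<And>C i. C \<in> \<C> \<Longrightarrow> i \<in> C \<Longrightarrow> \<sigma> i \<in> C"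
    and "\<And>C D. C \<in> \<C> \<Longrightarrow> D \<in> \<C> \<Longrightarrow> C \<noteq> D \<Longrightarrow> C \<inter> D = {}"
  shows "state_sum (\<Union>\<C>) \<sigma> B = (\<Prod>C\<in>\<C>. state_sum C \<sigma> B)"
  using assms
proof (induction \<C> rule: finite_induct)
  case empty
  show ?case by (simp add: state_sum_def)
next
  case (insert C \<C>)
  have "state_sum (C \<union> \<Union>\<C>) \<sigma> B = state_sum C \<sigma> B * state_sum (\<Union>\<C>) \<sigma> B"
  proof (rule state_sum_Un)
    have "C \<inter> D = {}" if "D \<in> \<C>" for D
      using insert.prems(3)[of C D] insert.hyps that by auto
    then show "C \<inter> \<Union>\<C> = {}" by blast
  qed (use insert in auto)
  then show ?case using insert by simp
qed

section \<open>Entries of trace monomials\<close>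

lemma mat_prod_list_Nil [simp]: "mat_prod_list [] = mat 1"
  and mat_prod_list_Cons [simp]: "mat_prod_list (M # Ms) = M ** mat_prod_list Ms"
  by (simp_all add: mat_prod_list_def)

lemma mat_prod_list_snoc: "mat_prod_list (Ms @ [M]) = mat_prod_list Ms ** M"
  by (induction Ms) (simp_all add: matrix_mul_assoc)

lemma mat_prod_list_entry:
  fixes M :: "nat \<Rightarrow> complex^'n^'n::finite"
  shows "mat_prod_list (map M [0..<k]) $ a $ b =
    (\<Sum>w | w \<in> {0..k} \<rightarrow>\<^sub>E UNIV \<and> w 0 = a \<and> w k = b. \<Prod>j<k. M j $ w j $ w (Suc j))"
proof (induction k arbitrary: b)
  case 0
  have "{w. w \<in> {0..0::nat} \<rightarrow>\<^sub>E (UNIV :: 'n set) \<and> w 0 = a \<and> w 0 = b} =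
      (if a = b then {\<lambda>j\<in>{0}. a} else {})"
    by (auto simp: fun_eq_iff PiE_def extensional_def restrict_def)
  then show ?case by (simp add: mat_def)
next
  case (Suc k)
  let ?W = "\<lambda>c. {w \<in> {0..k} \<rightarrow>\<^sub>E (UNIV :: 'n set). w 0 = a \<and> w k = c}"
  let ?V = "{w \<in> {0..k} \<rightarrow>\<^sub>E (UNIV :: 'n set). w 0 = a}"
  have fin: "finite ({0..k} \<rightarrow>\<^sub>E (UNIV :: 'n set))" by (intro finite_PiE) auto
  have "mat_prod_list (map M [0..<Suc k]) $ a $ b =
      (\<Sum>c\<in>UNIV. \<Sum>w\<in>?W c. (\<Prod>j<k. M j $ w j $ w (Suc j)) * M k $ c $ b)"
    by (simp add: mat_prod_list_snoc matrix_matrix_mult_def Suc sum_distrib_right)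
  also have "\<dots> = (\<Sum>c\<in>UNIV. \<Sum>w | w \<in> ?V \<and> w k = c.
      (\<Prod>j<k. M j $ w j $ w (Suc j)) * M k $ w k $ b)"
    by (intro sum.cong) auto
  also have "\<dots> = (\<Sum>w\<in>?V. (\<Prod>j<k. M j $ w j $ w (Suc j)) * M k $ w k $ b)"
    using fin by (intro sum.group) auto
  also have "\<dots> = (\<Sum>w | w \<in> {0..Suc k} \<rightarrow>\<^sub>E UNIV \<and> w 0 = a \<and> w (Suc k) = b.
      \<Prod>j<Suc k. M j $ w j $ w (Suc j))"
    by (rule sum.reindex_bij_witness[where
          i = "\<lambda>w. restrict w {0..k}" and j = "\<lambda>w. w(Suc k := b)"])
       (auto simp: fun_eq_iff PiE_def extensional_def restrict_def)
  finally show ?case .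
qed

text \<open>
  The trace closes up the walk of length \<open>k\<close>, so that its last label, at position \<open>k\<close>,
  repeats the label at position \<open>0\<close>.
\<close>

lemma state_sum_cycle_mod:
  fixes M :: "nat \<Rightarrow> complex^'n^'n::finite"
  assumes "0 < k"
  shows "state_sum {0..<k} (\<lambda>j. Suc j mod k) M = trace (mat_prod_list (map M [0..<k]))"
proof -
  have fin: "finite ({0..k} \<rightarrow>\<^sub>E (UNIV :: 'n set))" by (intro finite_PiE) auto
  have "trace (mat_prod_list (map M [0..<k])) =
      (\<Sum>a\<in>UNIV. \<Sum>w | w \<in> {w \<in> {0..k} \<rightarrow>\<^sub>E UNIV. w k = w 0} \<and> w 0 = a.
         \<Prod>j<k. M j $ w j $ w (Suc j))"
    unfolding trace_def mat_prod_list_entry by (intro sum.cong) auto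
  also have "\<dots> = (\<Sum>w\<in>{w \<in> {0..k} \<rightarrow>\<^sub>E UNIV. w k = w 0}. \<Prod>j<k. M j $ w j $ w (Suc j))"
    using fin by (intro sum.group) auto
  also have "\<dots> = state_sum {0..<k} (\<lambda>j. Suc j mod k) M"
    unfolding state_sum_def
  proof (rule sum.reindex_bij_witness[where
        j = "\<lambda>w. restrict w {0..<k}" and i = "\<lambda>u. \<lambda>j\<in>{0..k}. u (j mod k)"], goal_cases)
    case (1 w)
    then show ?case using assms
      by (auto simp: fun_eq_iff PiE_def extensional_def le_less)
  next
    case (3 u)
    then show ?case using assms
      by (auto simp: fun_eq_iff PiE_def extensional_def)
  next
    case (5 w)
    have "restrict w {0..<k} (Suc j mod k) = w (Suc j)" if "j < k" for j
      using 5 that assms by (cases "Suc j = k") auto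
    then show ?case by (intro prod.cong) auto
  qed (use assms in auto)
  finally show ?thesis by simp
qed

lemma cyclic_on_bij_betw:
  assumes "cyclic_on \<sigma> C" "c \<in> C"
  shows "bij_betw (\<lambda>j. (\<sigma> ^^ j) c) {0..<card C} C"
    and "(\<sigma> ^^ card C) c = c"
proof -
  have C: "C = orbit \<sigma> c" and c: "c \<in> orbit \<sigma> c"
    using assms by (auto simp: cyclic_on_alldef)
  let ?d = "funpow_dist1 \<sigma> c c"
  have inj: "inj_on (\<lambda>j. (\<sigma> ^^ j) c) {0..<?d}" and img: "C = (\<lambda>j. (\<sigma> ^^ j) c) ` {0..<?d}"
    using inj_on_funpow_dist1[OF c] orbit_conv_funpow_dist1[OF c] C by auto
  have k: "card C = ?d" by (subst img) (simp add: card_image[OF inj])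
  show "bij_betw (\<lambda>j. (\<sigma> ^^ j) c) {0..<card C} C" unfolding k using inj img
    by (simp add: bij_betw_def)
  show "(\<sigma> ^^ card C) c = c" unfolding k by (rule funpow_dist1_prop[OF c])
qed

lemma state_sum_cyclic:
  assumes "cyclic_on \<sigma> C" "c \<in> C"
  shows "state_sum C \<sigma> B = trace (mat_prod_list (map (\<lambda>j. B ((\<sigma> ^^ j) c)) [0..<card C]))"
proof -
  have pos: "0 < card C" using assms finite_cyclic_on card_gt_0_iff by blast
  have "state_sum C \<sigma> B =
      state_sum {0..<card C} (\<lambda>j. Suc j mod card C) (B \<circ> (\<lambda>j. (\<sigma> ^^ j) c))"
    using cyclic_on_bij_betw[OF assms] pos
    by (intro state_sum_reindex) (auto simp: funpow_mod_eq)
  then show ?thesis using pos by (simp add: state_sum_cycle_mod comp_def)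
qed

lemma orbit_disjoint:
  assumes "permutation \<sigma>" "orbit \<sigma> x \<noteq> orbit \<sigma> y"
  shows "orbit \<sigma> x \<inter> orbit \<sigma> y = {}"
proof -
  have "orbit \<sigma> y = orbit \<sigma> x" if "z \<in> orbit \<sigma> x" "z \<in> orbit \<sigma> y" for z
    using orbit_cyclic_eq3[OF cyclic_on_orbit'[OF assms(1)]] that by metis
  then show ?thesis using assms(2) by blast
qed

lemma Union_orbits:
  assumes "\<sigma> permutes A" "finite A"
  shows "\<Union> (orbit \<sigma> ` A) = A"
proof
  show "\<Union> (orbit \<sigma> ` A) \<subseteq> A" using permutes_orbit_subset[OF assms(1)] by blast
  have "permutation \<sigma>" using assms by (auto simp: permutation_permutes)
  then show "A \<subseteq> \<Union> (orbit \<sigma> ` A)" using permutation_self_in_orbit by fast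
qed

text \<open>
  Labels on different cycles of \<open>\<sigma>\<close> do not interact, hence the sum factors over the cycles;
  on a single cycle it is the index expansion of a trace.
\<close>

lemma state_sum_permutes:
  fixes B :: "'a::linorder \<Rightarrow> complex^'n^'n::finite"
  assumes "\<sigma> permutes A" "finite A"
  shows "state_sum A \<sigma> B =
    (\<Prod>C\<in>orbit \<sigma> ` A. trace (mat_prod_list (map (\<lambda>j. B ((\<sigma> ^^ j) (Min C))) [0..<card C])))"
proof -
  have perm: "permutation \<sigma>" using assms by (auto simp: permutation_permutes)
  have "state_sum (\<Union> (orbit \<sigma> ` A)) \<sigma> B = (\<Prod>C\<in>orbit \<sigma> ` A. state_sum C \<sigma> B)"
    using assms(2) perm orbit_disjoint[OF perm]
    by (intro state_sum_Union) (auto intro: orbit.step finite_orbit permutation_self_in_orbit)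
  also have "\<dots> = (\<Prod>C\<in>orbit \<sigma> ` A.
      trace (mat_prod_list (map (\<lambda>j. B ((\<sigma> ^^ j) (Min C))) [0..<card C])))"
  proof (rule prod.cong[OF refl])
    fix C assume "C \<in> orbit \<sigma> ` A"
    then have C: "cyclic_on \<sigma> C" using cyclic_on_orbit'[OF perm] by auto
    then have "Min C \<in> C" using finite_cyclic_on[OF C] by (intro Min_in) (auto simp: cyclic_on_alldef)
    then show "state_sum C \<sigma> B =
        trace (mat_prod_list (map (\<lambda>j. B ((\<sigma> ^^ j) (Min C))) [0..<card C]))"
      by (rule state_sum_cyclic[OF C])
  qed
  finally show ?thesis by (simp add: Union_orbits[OF assms])
qed

lemma trace_matrix_unit_mult: "trace (matrix_unit r l ** P) = P $ l $ r"
proof -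
  have "trace (matrix_unit r l ** P) = (\<Sum>i\<in>UNIV. \<Sum>k\<in>UNIV. if k = l then if i = r then P $ k $ i else 0 else 0)"
    unfolding trace_def matrix_matrix_mult_def matrix_unit_def
    by (auto intro!: sum.cong simp del: sum.delta sum.delta')
  then show ?thesis by simp
qed

text \<open>
  The cycle of \<open>0\<close> contributes a matrix to \<open>tr_perm\<close>, while the other cycles contribute traces.
  Placing a matrix unit at \<open>0\<close> removes the difference: by \<open>trace_matrix_unit_mult\<close> an entry of the
  open product is the trace of the product around the whole cycle. The same matrix unit encodes the
  conditions \<open>u 0 = r\<close> and \<open>u (\<sigma> 0) = l\<close> on the labelling.
\<close>

lemma tr_perm_entry:
  assumes "\<sigma> permutes {0..n}"
  shows "tr_perm n \<sigma> A $ l $ r = state_sum {0..n} \<sigma> (A(0 := matrix_unit r l))"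
proof -
  let ?B = "A(0 := matrix_unit r l)"
  define F where "F B C = trace (mat_prod_list (map (\<lambda>j. B ((\<sigma> ^^ j) (Min C))) [0..<card C]))"
    for B :: "nat \<Rightarrow> complex^'a^'a" and C
  have perm: "permutation \<sigma>" using assms by (auto simp: permutation_permutes)
  let ?O = "orbit \<sigma> 0"
  have cyc: "cyclic_on \<sigma> (orbit \<sigma> x)" for x using cyclic_on_orbit'[OF perm] .
  have z: "0 \<in> ?O" using permutation_self_in_orbit[OF perm] .
  have fO: "finite ?O" using finite_orbit[OF z] .
  have split: "orbit \<sigma> ` {0..n} = insert ?O (cycles0 {0..n} \<sigma>)"
  proof (intro set_eqI iffI)
    fix C assume C: "C \<in> orbit \<sigma> ` {0..n}"
    show "C \<in> insert ?O (cycles0 {0..n} \<sigma>)"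
    proof (cases "0 \<in> C")
      case True
      then have "C = ?O" using C cyc orbit_cyclic_eq3 by (metis imageE)
      then show ?thesis by simp
    qed (use C in \<open>auto simp: cycles0_def\<close>)
  qed (auto simp: cycles0_def)
  have cong: "F ?B C = F A C" if "C \<in> cycles0 {0..n} \<sigma>" for C
  proof -
    have C: "cyclic_on \<sigma> C" "0 \<notin> C" using that cyc by (auto simp: cycles0_def)
    then have "Min C \<in> C" using finite_cyclic_on[OF C(1)]
      by (intro Min_in) (auto simp: cyclic_on_alldef)
    then have "(\<sigma> ^^ j) (Min C) \<noteq> 0" for j using cyclic_on_funpow_in[OF C(1)] C(2) by metis
    then have "?B ((\<sigma> ^^ j) (Min C)) = A ((\<sigma> ^^ j) (Min C))" for j
      by (metis fun_upd_other)
    then show ?thesis by (simp only: F_def)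
  qed
  have "F ?B ?O = trace (matrix_unit r l ** mat_prod_list (map (\<lambda>j. A ((\<sigma> ^^ j) 0)) [1..<card ?O]))"
  proof -
    have mn: "Min ?O = 0" using z fO by (meson Min_le le_zero_eq)
    have pos: "0 < card ?O" using z fO card_gt_0_iff by blast
    have ne: "(\<sigma> ^^ j) 0 \<noteq> 0" if "j \<in> {1..<card ?O}" for j
    proof
      assume "(\<sigma> ^^ j) 0 = 0"
      moreover have "inj_on (\<lambda>j. (\<sigma> ^^ j) 0) {0..<card ?O}"
        using cyclic_on_bij_betw(1)[OF cyc z] by (simp add: bij_betw_def)
      ultimately show False using that inj_onD[of "\<lambda>j. (\<sigma> ^^ j) 0" "{0..<card ?O}" j 0] by auto
    qed
    have "map (\<lambda>j. ?B ((\<sigma> ^^ j) 0)) [1..<card ?O] = map (\<lambda>j. A ((\<sigma> ^^ j) 0)) [1..<card ?O]"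
      by (intro map_cong refl) (simp only: fun_upd_apply ne if_False set_upt)
    then have "map (\<lambda>j. ?B ((\<sigma> ^^ j) (Min ?O))) [0..<card ?O] =
        matrix_unit r l # map (\<lambda>j. A ((\<sigma> ^^ j) 0)) [1..<card ?O]"
      by (simp only: mn upt_conv_Cons[OF pos] list.map One_nat_def) simp
    then show ?thesis by (simp only: F_def mat_prod_list_Cons)
  qed
  then have O: "F ?B ?O = mat_prod_list (map (\<lambda>j. A ((\<sigma> ^^ j) 0)) [1..<card ?O]) $ l $ r"
    by (simp add: trace_matrix_unit_mult)
  have "state_sum {0..n} \<sigma> ?B = (\<Prod>C\<in>orbit \<sigma> ` {0..n}. F ?B C)"
    unfolding F_def using assms by (intro state_sum_permutes) auto
  also have "\<dots> = F ?B ?O * (\<Prod>C\<in>cycles0 {0..n} \<sigma>. F ?B C)"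
    unfolding split using z by (subst prod.insert) (auto simp: cycles0_def)
  also have "(\<Prod>C\<in>cycles0 {0..n} \<sigma>. F ?B C) = (\<Prod>C\<in>cycles0 {0..n} \<sigma>. F A C)"
    by (rule prod.cong) (simp_all add: cong)
  finally have "state_sum {0..n} \<sigma> ?B = (\<Prod>C\<in>cycles0 {0..n} \<sigma>. F A C) *
      mat_prod_list (map (\<lambda>j. A ((\<sigma> ^^ j) 0)) [1..<card ?O]) $ l $ r"
    by (simp only: O mult.commute)
  then show ?thesis by (simp add: tr_perm_def mat_scale_def F_def)
qed

section \<open>Skipping points of a permutation\<close>

text \<open>
  The first point outside \<open>S\<close> met along the orbit of \<open>x\<close>, the start \<open>x\<close> included. In contrast to
  \<open>skip_perm\<close> it moves points of \<open>S\<close>; it is meaningful if the orbit leaves \<open>S\<close>.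
\<close>

definition exit_point :: "('a \<Rightarrow> 'a) \<Rightarrow> 'a set \<Rightarrow> 'a \<Rightarrow> 'a" where
  "exit_point \<beta> S x = (\<beta> ^^ (LEAST m. (\<beta> ^^ m) x \<notin> S)) x"

lemma exit_point_outside [simp]: "x \<notin> S \<Longrightarrow> exit_point \<beta> S x = x"
proof -
  assume "x \<notin> S"
  then have "(LEAST m. (\<beta> ^^ m) x \<notin> S) = 0" by (intro Least_eq_0) simp
  then show ?thesis by (simp add: exit_point_def)
qed

lemma orbit_leaves:
  assumes "permutation \<beta>" "\<not> orbit \<beta> x \<subseteq> S"
  shows "\<exists>m. (\<beta> ^^ m) x \<notin> S"
  using assms by (auto simp: orbit_altdef)

lemma not_orbit_subset:
  assumes "permutation \<beta>" "x \<notin> S"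
  shows "\<not> orbit \<beta> x \<subseteq> S"
  using permutation_self_in_orbit[OF assms(1), of x] assms(2) by auto

lemma exit_point_step:
  assumes "permutation \<beta>" "\<not> orbit \<beta> x \<subseteq> S" "x \<in> S"
  shows "exit_point \<beta> S (\<beta> x) = exit_point \<beta> S x"
proof -
  obtain m where m: "(\<beta> ^^ m) x \<notin> S" using orbit_leaves[OF assms(1,2)] by blast
  have "(LEAST m. (\<beta> ^^ m) x \<notin> S) = Suc (LEAST m. (\<beta> ^^ Suc m) x \<notin> S)"
    by (rule Least_Suc[where P = "\<lambda>m. (\<beta> ^^ m) x \<notin> S", OF m]) (use assms in auto)
  then show ?thesis by (simp add: exit_point_def funpow_swap1)
qed

lemma exit_point_notin:
  assumes "permutation \<beta>" "\<not> orbit \<beta> x \<subseteq> S"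
  shows "exit_point \<beta> S x \<notin> S"
  unfolding exit_point_def using orbit_leaves[OF assms] by (rule LeastI_ex)

lemma skip_perm_exit_point:
  assumes "permutation \<beta>" "x \<notin> S"
  shows "skip_perm \<beta> S x = exit_point \<beta> S (\<beta> x)"
proof -
  have "\<not> orbit \<beta> (\<beta> x) \<subseteq> S" using not_orbit_subset[OF assms] by (simp add: permutation_orbit_step[OF assms(1)])
  then obtain m where m: "(\<beta> ^^ m) (\<beta> x) \<notin> S" using orbit_leaves[OF assms(1)] by blast
  have "(LEAST m. 0 < m \<and> (\<beta> ^^ m) x \<notin> S) = Suc (LEAST m. 0 < Suc m \<and> (\<beta> ^^ Suc m) x \<notin> S)"
    by (rule Least_Suc[where P = "\<lambda>m. 0 < m \<and> (\<beta> ^^ m) x \<notin> S" and n = "Suc m"])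
       (use m in \<open>auto simp: funpow_swap1\<close>)
  then show ?thesis using assms by (simp add: exit_point_def skip_perm_def funpow_swap1)
qed

lemma constant_until_exit:
  assumes "permutation \<beta>" "\<And>i. i \<in> S \<Longrightarrow> u (\<beta> i) = u i" "\<not> orbit \<beta> x \<subseteq> S"
  shows "u x = u (exit_point \<beta> S x)"
proof -
  have "u ((\<beta> ^^ k) x) = u x" if "k \<le> (LEAST m. (\<beta> ^^ m) x \<notin> S)" for k
    using that
  proof (induction k)
    case (Suc k)
    then have "(\<beta> ^^ k) x \<in> S" using not_less_Least[of k "\<lambda>m. (\<beta> ^^ m) x \<notin> S"] by auto
    then show ?case using Suc assms(2) by simp
  qed simp
  then show ?thesis by (simp add: exit_point_def)
qed

lemma exit_point_in_orbit:
  assumes "permutation \<beta>"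
  shows "exit_point \<beta> S x \<in> orbit \<beta> x"
  using funpow_in_orbit[OF permutation_self_in_orbit[OF assms]] by (simp add: exit_point_def)

lemma skip_perm_in_orbit:
  assumes "permutation \<beta>" "x \<notin> S"
  shows "skip_perm \<beta> S x \<in> orbit \<beta> x - S"
proof -
  have "\<not> orbit \<beta> (\<beta> x) \<subseteq> S" using not_orbit_subset[OF assms] by (simp add: permutation_orbit_step[OF assms(1)])
  then show ?thesis using exit_point_notin[OF assms(1)] exit_point_in_orbit[OF assms(1), of S "\<beta> x"]
    by (auto simp: skip_perm_exit_point[OF assms] permutation_orbit_step[OF assms(1)])
qed

text \<open>
  Following the full orbit and recording only exit points visits exactly the points that
  \<open>skip_perm\<close> visits, so skipping \<open>S\<close> deletes \<open>S\<close> from each cycle and neither merges nor splits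
  cycles.
\<close>

lemma orbit_skip_perm:
  fixes x :: nat
  assumes perm: "permutation \<beta>" and x: "x \<notin> S"
  shows "orbit (skip_perm \<beta> S) x = orbit \<beta> x - S"
proof (intro subset_antisym subsetI)
  fix y assume "y \<in> orbit (skip_perm \<beta> S) x"
  then show "y \<in> orbit \<beta> x - S"
  proof induction
    case base
    show ?case by (rule skip_perm_in_orbit[OF assms])
  next
    case (step y)
    then have "skip_perm \<beta> S y \<in> orbit \<beta> y - S" by (intro skip_perm_in_orbit[OF perm]) auto
    then show ?case using step.IH by (auto intro: orbit_trans)
  qed
next
  have *: "exit_point \<beta> S ((\<beta> ^^ Suc k) x) \<in> orbit (skip_perm \<beta> S) x" for k
  proof (induction k)
    case 0
    show ?case using skip_perm_exit_point[OF assms] orbit.base[of "skip_perm \<beta> S" x] by simp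
  next
    case (Suc k)
    let ?z = "(\<beta> ^^ Suc k) x"
    show ?case
    proof (cases "?z \<in> S")
      case True
      have "orbit \<beta> ?z = orbit \<beta> x"
        using funpow_in_orbit[OF permutation_self_in_orbit[OF perm]]
          orbit_cyclic_eq3[OF cyclic_on_orbit'[OF perm]] by blast
      then have "\<not> orbit \<beta> ?z \<subseteq> S" using not_orbit_subset[OF assms] by simp
      then show ?thesis using Suc exit_point_step[OF perm _ True] by simp
    next
      case False
      then have "?z \<in> orbit (skip_perm \<beta> S) x" using Suc by simp
      then show ?thesis using orbit.step skip_perm_exit_point[OF perm False] by fastforce
    qed
  qed
  fix y assume y: "y \<in> orbit \<beta> x - S"
  then obtain m where "y = (\<beta> ^^ m) x" "0 < m" by (auto simp: orbit_altdef)
  then obtain k where "y = (\<beta> ^^ Suc k) x" using gr0_implies_Suc by blast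
  then show "y \<in> orbit (skip_perm \<beta> S) x" using *[of k] y by simp
qed

lemma skip_perm_permutes:
  assumes \<beta>: "\<beta> permutes A" "finite A"
  shows "skip_perm \<beta> S permutes (A - S)"
proof (rule bij_imp_permutes)
  have perm: "permutation \<beta>" using assms by (auto simp: permutation_permutes)
  have maps: "skip_perm \<beta> S x \<in> A - S" if "x \<in> A - S" for x
    using skip_perm_in_orbit[OF perm, of x S] permutes_orbit_subset[OF \<beta>(1), of x] that by auto
  have surj: "y \<in> skip_perm \<beta> S ` (A - S)" if "y \<in> A - S" for y
  proof -
    have "y \<in> orbit (skip_perm \<beta> S) y"
      using that permutation_self_in_orbit[OF perm] by (simp add: orbit_skip_perm[OF perm])
    then obtain z where z: "y = skip_perm \<beta> S z" "z = y \<or> z \<in> orbit (skip_perm \<beta> S) y"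
      by cases auto
    then have "z \<in> A - S"
      using that permutes_orbit_subset[OF \<beta>(1), of y] by (auto simp: orbit_skip_perm[OF perm])
    then show ?thesis using z(1) by blast
  qed
  have img: "skip_perm \<beta> S ` (A - S) = A - S" using maps surj by blast
  then have "inj_on (skip_perm \<beta> S) (A - S)" using \<beta>(2) by (intro eq_card_imp_inj_on) auto
  then show "bij_betw (skip_perm \<beta> S) (A - S) (A - S)" using img by (simp add: bij_betw_def)
  fix x assume "x \<notin> A - S"
  show "skip_perm \<beta> S x = x"
  proof (cases "x \<in> S")
    case False
    then have "\<beta> x = x" using \<open>x \<notin> A - S\<close> \<beta>(1) by (auto simp: permutes_def)
    then show ?thesis using False by (simp add: skip_perm_exit_point[OF perm])
  qed (simp add: skip_perm_def)
qed

definition inner_cycles :: "'a set \<Rightarrow> ('a \<Rightarrow> 'a) \<Rightarrow> 'a set \<Rightarrow> 'a set set" where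
  "inner_cycles A \<beta> S = {C \<in> orbit \<beta> ` A. C \<subseteq> S}"

text \<open>
  The cycles that are lost by skipping \<open>S\<close> are those contained in \<open>S\<close>; every other cycle \<open>C\<close>
  survives as \<open>C - S\<close>. This identifies the exponent of \<open>q\<close> in the contraction.
\<close>

lemma cyc0_skip_perm:
  assumes \<beta>: "\<beta> permutes A" "finite A" and S: "0 \<notin> S"
  shows "cyc0 A \<beta> = card (inner_cycles A \<beta> S) + cyc0 (A - S) (skip_perm \<beta> S)"
proof -
  have perm: "permutation \<beta>" using assms by (auto simp: permutation_permutes)
  let ?R = "{C \<in> cycles0 A \<beta>. \<not> C \<subseteq> S}"
  have fin: "finite (cycles0 A \<beta>)" using \<beta> by (auto simp: cycles0_def)
  have "cycles0 A \<beta> = inner_cycles A \<beta> S \<union> ?R"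
    using S by (auto simp: cycles0_def inner_cycles_def)
  then have "card (cycles0 A \<beta>) = card (inner_cycles A \<beta> S) + card ?R"
    using fin by (metis (no_types, lifting) card_Un_disjoint finite_Un inner_cycles_def
        disjoint_iff mem_Collect_eq)
  also have "card ?R = card (cycles0 (A - S) (skip_perm \<beta> S))"
  proof (rule bij_betw_same_card[of "\<lambda>C. C - S"], unfold bij_betw_def, intro conjI)
    show "inj_on (\<lambda>C. C - S) ?R"
    proof (rule inj_onI)
      fix C D assume CD: "C \<in> ?R" "D \<in> ?R" "C - S = D - S"
      then obtain c where "c \<in> C" "c \<in> D" by blast
      moreover obtain x y where "C = orbit \<beta> x" "D = orbit \<beta> y"
        using CD by (auto simp: cycles0_def)
      ultimately show "C = D" using orbit_disjoint[OF perm] by blast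
    qed
    show "(\<lambda>C. C - S) ` ?R = cycles0 (A - S) (skip_perm \<beta> S)"
    proof (intro subset_antisym subsetI)
      fix D assume "D \<in> (\<lambda>C. C - S) ` ?R"
      then obtain x where x: "x \<in> A" "0 \<notin> orbit \<beta> x" "\<not> orbit \<beta> x \<subseteq> S" "D = orbit \<beta> x - S"
        by (auto simp: cycles0_def)
      then obtain y where y: "y \<in> orbit \<beta> x" "y \<notin> S" by blast
      then have "orbit \<beta> y = orbit \<beta> x" using orbit_cyclic_eq3[OF cyclic_on_orbit'[OF perm]] by blast
      moreover have "y \<in> A" using y permutes_orbit_subset[OF \<beta>(1) x(1)] by blast
      ultimately show "D \<in> cycles0 (A - S) (skip_perm \<beta> S)"
        using y x orbit_skip_perm[OF perm y(2)] by (auto simp: cycles0_def)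
    next
      fix D assume "D \<in> cycles0 (A - S) (skip_perm \<beta> S)"
      then obtain x where "x \<in> A" "x \<notin> S" "D = orbit \<beta> x - S" "0 \<notin> D"
        using orbit_skip_perm[OF perm] by (auto simp: cycles0_def)
      then show "D \<in> (\<lambda>C. C - S) ` ?R"
        using S permutation_self_in_orbit[OF perm, of x] by (auto simp: cycles0_def)
    qed
  qed
  finally show ?thesis by (simp add: cyc0_def)
qed

text \<open>
  A labelling that is preserved by \<open>\<beta>\<close> at all points of \<open>S\<close> is constant up to the exit from
  \<open>S\<close>. It is therefore given by arbitrary labels on \<open>A - S\<close>, which are pulled back to \<open>S\<close> along
  \<open>exit_point\<close>, and by one free label for each cycle inside \<open>S\<close>; the latter do not occur in the
  product and give the power of the dimension.
\<close>

lemma state_sum_skip_perm: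
  fixes \<beta> :: "nat \<Rightarrow> nat" and B :: "nat \<Rightarrow> complex^'n^'n::finite"
  assumes \<beta>: "\<beta> permutes A" "finite A" and S: "S \<subseteq> A"
  shows "(\<Sum>u | u \<in> A \<rightarrow>\<^sub>E UNIV \<and> (\<forall>i\<in>S. u (\<beta> i) = u i). \<Prod>i\<in>A - S. B i $ u i $ u (\<beta> i)) =
    of_nat (CARD('n) ^ card (inner_cycles A \<beta> S)) * state_sum (A - S) (skip_perm \<beta> S) B"
proof -
  have perm: "permutation \<beta>" using assms by (auto simp: permutation_permutes)
  define I where "I = inner_cycles A \<beta> S"
  define \<gamma> where "\<gamma> = skip_perm \<beta> S"
  have \<gamma>: "\<gamma> i \<in> A - S" if "i \<in> A - S" for i
    using permutes_in_image[OF skip_perm_permutes[OF \<beta>, of S], of i] that by (auto simp: \<gamma>_def)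
  have finI: "finite I" using \<beta> by (simp add: I_def inner_cycles_def)
  have step: "orbit \<beta> (\<beta> x) = orbit \<beta> x" for x by (rule permutation_orbit_step[OF perm])
  have self: "x \<in> orbit \<beta> x" for x by (rule permutation_self_in_orbit[OF perm])
  have eqI: "orbit \<beta> y = orbit \<beta> x" if "y \<in> orbit \<beta> x" for x y
    using orbit_cyclic_eq3[OF cyclic_on_orbit'[OF perm] that] .
  have inI: "orbit \<beta> i \<in> I \<longleftrightarrow> orbit \<beta> i \<subseteq> S" if "i \<in> A" for i
    using that by (auto simp: I_def inner_cycles_def)
  have MinI: "Min C \<in> C \<and> C \<subseteq> S \<and> orbit \<beta> (Min C) = C" if "C \<in> I" for C
  proof -
    obtain x where x: "C = orbit \<beta> x" "C \<subseteq> S" using \<open>C \<in> I\<close> unfolding I_def inner_cycles_def by blast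
    then have "Min C \<in> C" using self finite_orbit orbit_nonempty by (metis Min_in)
    then show ?thesis using eqI x by blast
  qed
  have exit: "exit_point \<beta> S i \<in> A - S" if "i \<in> A" "\<not> orbit \<beta> i \<subseteq> S" for i
    using exit_point_notin[OF perm that(2)] exit_point_in_orbit[OF perm]
      permutes_orbit_subset[OF \<beta>(1) that(1)] by blast
  let ?U = "{u \<in> A \<rightarrow>\<^sub>E (UNIV :: 'n set). \<forall>i\<in>S. u (\<beta> i) = u i}"
  let ?ext = "\<lambda>(v :: nat \<Rightarrow> 'n, w). \<lambda>i\<in>A. if orbit \<beta> i \<subseteq> S then w (orbit \<beta> i) else v (exit_point \<beta> S i)"
  let ?res = "\<lambda>u :: nat \<Rightarrow> 'n. (restrict u (A - S), \<lambda>C\<in>I. u (Min C))"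
  have "(\<Sum>u\<in>?U. \<Prod>i\<in>A - S. B i $ u i $ u (\<beta> i)) =
      (\<Sum>(v, w)\<in>(A - S \<rightarrow>\<^sub>E (UNIV :: 'n set)) \<times> (I \<rightarrow>\<^sub>E (UNIV :: 'n set)). \<Prod>i\<in>A - S. B i $ v i $ v (\<gamma> i))"
  proof (rule sum.reindex_bij_witness[where i = ?ext and j = ?res])
    fix u assume u: "u \<in> ?U"
    have const: "u ((\<beta> ^^ m) i) = u i" if "orbit \<beta> i \<subseteq> S" for i m
    proof (induction m)
      case (Suc m)
      have "(\<beta> ^^ m) i \<in> S" using funpow_in_orbit[OF self] that by blast
      then show ?case using u Suc by simp
    qed simp
    have "u (Min (orbit \<beta> i)) = u i" if "i \<in> A" "orbit \<beta> i \<subseteq> S" for i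
    proof -
      have "Min (orbit \<beta> i) \<in> orbit \<beta> i" using MinI[of "orbit \<beta> i"] inI[OF that(1)] that(2) by blast
      then obtain m where "Min (orbit \<beta> i) = (\<beta> ^^ m) i" by (auto simp: orbit_altdef)
      then show ?thesis using const[OF that(2)] by simp
    qed
    moreover have "u (exit_point \<beta> S i) = u i" if "\<not> orbit \<beta> i \<subseteq> S" for i
      using constant_until_exit[OF perm _ that, of u] u by simp
    ultimately show "?ext (?res u) = u"
      using u inI exit by (auto simp: fun_eq_iff PiE_def extensional_def)
    show "?res u \<in> (A - S \<rightarrow>\<^sub>E UNIV) \<times> (I \<rightarrow>\<^sub>E UNIV)" by auto
    have "u (\<beta> i) = u (\<gamma> i)" if "i \<in> A - S" for i
    proof -
      have "\<not> orbit \<beta> (\<beta> i) \<subseteq> S" using not_orbit_subset[OF perm] that step by simp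
      then show ?thesis using constant_until_exit[OF perm, of S u "\<beta> i"] u that
        by (simp add: \<gamma>_def skip_perm_exit_point[OF perm])
    qed
    then have "(\<Prod>i\<in>A - S. B i $ u i $ u (\<beta> i)) =
        (\<Prod>i\<in>A - S. B i $ restrict u (A - S) i $ restrict u (A - S) (\<gamma> i))"
      using \<gamma> by (intro prod.cong) auto
    then show "(case ?res u of (v, w) \<Rightarrow> \<Prod>i\<in>A - S. B i $ v i $ v (\<gamma> i)) =
        (\<Prod>i\<in>A - S. B i $ u i $ u (\<beta> i))" by simp
  next
    fix p assume "p \<in> (A - S \<rightarrow>\<^sub>E (UNIV :: 'n set)) \<times> (I \<rightarrow>\<^sub>E (UNIV :: 'n set))"
    then obtain v w where p: "p = (v, w)" "v \<in> A - S \<rightarrow>\<^sub>E UNIV" "w \<in> I \<rightarrow>\<^sub>E UNIV" by auto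
    have "?ext p (\<beta> i) = ?ext p i" if "i \<in> S" for i
    proof -
      have "i \<in> A" "\<beta> i \<in> A" using that S permutes_in_image[OF \<beta>(1)] by auto
      then show ?thesis using exit_point_step[OF perm _ that] by (simp add: p step)
    qed
    then show "?ext p \<in> ?U" by (auto simp: p)
    have "\<not> orbit \<beta> i \<subseteq> S" if "i \<notin> S" for i by (rule not_orbit_subset[OF perm that])
    then have "restrict (?ext p) (A - S) = v"
      using p(2) by (auto simp: p(1) fun_eq_iff PiE_def extensional_def)
    moreover have "(\<lambda>C\<in>I. ?ext p (Min C)) = w"
    proof
      fix C show "(\<lambda>C\<in>I. ?ext p (Min C)) C = w C"
      proof (cases "C \<in> I")
        case True
        then have "Min C \<in> A" using MinI S by blast
        then show ?thesis using True MinI[OF True] by (simp add: p(1))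
      qed (use p(3) in \<open>auto simp: PiE_def extensional_def\<close>)
    qed
    ultimately show "?res (?ext p) = p" by (simp add: p(1))
  qed
  also have "\<dots> = of_nat (card (I \<rightarrow>\<^sub>E (UNIV :: 'n set))) * state_sum (A - S) \<gamma> B"
    by (simp add: state_sum_def sum.cartesian_product[symmetric] sum_distrib_left)
  also have "card (I \<rightarrow>\<^sub>E (UNIV :: 'n set)) = CARD('n) ^ card I"
    using finI by (simp add: card_PiE)
  finally show ?thesis by (simp add: I_def \<gamma>_def)
qed

section \<open>Relabelling\<close>

lemma card_less_nth_sorted_list_of_set:
  fixes A :: "nat set"
  assumes "finite A" "a \<in> A"
  shows "card {y \<in> A. y < a} < card A" "sorted_list_of_set A ! card {y \<in> A. y < a} = a"
proof -
  let ?xs = "sorted_list_of_set A"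
  have len: "length ?xs = card A" by simp
  obtain j where j: "j < card A" "?xs ! j = a"
    using assms by (metis in_set_conv_nth len set_sorted_list_of_set)
  have mono: "?xs ! i < ?xs ! k \<longleftrightarrow> i < k" if "i < card A" "k < card A" for i k
    using that strict_sorted_list_of_set[of A]
    by (metis len linorder_neqE_nat not_less_iff_gr_or_eq sorted_wrt_iff_nth_less)
  have "{y \<in> A. y < a} = (!) ?xs ` {..<j}"
  proof (intro subset_antisym subsetI)
    fix y assume y: "y \<in> {y \<in> A. y < a}"
    then obtain i where "i < card A" "?xs ! i = y"
      using assms by (metis (no_types, lifting) in_set_conv_nth len mem_Collect_eq set_sorted_list_of_set)
    then show "y \<in> (!) ?xs ` {..<j}" using y j mono[of i j] by auto
  next
    fix y assume "y \<in> (!) ?xs ` {..<j}"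
    then obtain i where i: "i < j" "y = ?xs ! i" by auto
    then have "y \<in> A" using j assms(1) by (metis len less_trans nth_mem set_sorted_list_of_set)
    then show "y \<in> {y \<in> A. y < a}" using i j mono[of i j] by simp
  qed
  moreover have "inj_on ((!) ?xs) {..<j}"
    using j by (intro inj_on_nth) auto
  ultimately have "card {y \<in> A. y < a} = j" by (simp add: card_image)
  then show "card {y \<in> A. y < a} < card A" "?xs ! card {y \<in> A. y < a} = a" using j by simp_all
qed

lemma relabel_conjugates:
  assumes "finite A" "\<gamma> permutes A" "i < card A"
  shows "relabel A \<gamma> i < card A"
    and "sorted_list_of_set A ! relabel A \<gamma> i = \<gamma> (sorted_list_of_set A ! i)"
proof -
  have "sorted_list_of_set A ! i \<in> A"
    using assms by (metis nth_mem sorted_list_of_set.length_sorted_key_list_of_set set_sorted_list_of_set)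
  then have "\<gamma> (sorted_list_of_set A ! i) \<in> A" using permutes_in_image[OF assms(2)] by simp
  note card_less_nth_sorted_list_of_set[OF assms(1) this]
  then show "relabel A \<gamma> i < card A"
    and "sorted_list_of_set A ! relabel A \<gamma> i = \<gamma> (sorted_list_of_set A ! i)"
    using assms(3) by (simp_all add: relabel_def)
qed

lemma bij_betw_sorted_list_of_set:
  assumes "finite A"
  shows "bij_betw ((!) (sorted_list_of_set A)) {..<card A} A"
  using assms by (intro bij_betw_nth) auto

lemma relabel_permutes:
  assumes "finite A" "\<gamma> permutes A"
  shows "relabel A \<gamma> permutes {..<card A}"
proof (rule bij_imp_permutes)
  let ?e = "(!) (sorted_list_of_set A)"
  have e: "inj_on ?e {..<card A}" "\<And>i. i < card A \<Longrightarrow> ?e i \<in> A"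
    using bij_betw_sorted_list_of_set[OF assms(1)] by (auto simp: bij_betw_def)
  have "inj_on (relabel A \<gamma>) {..<card A}"
  proof (rule inj_onI)
    fix i j assume ij: "i \<in> {..<card A}" "j \<in> {..<card A}" "relabel A \<gamma> i = relabel A \<gamma> j"
    then have "\<gamma> (?e i) = \<gamma> (?e j)" using relabel_conjugates(2)[OF assms] by (metis lessThan_iff)
    then have "?e i = ?e j" using permutes_inj[OF assms(2)] by (simp add: inj_eq)
    then show "i = j" using e ij by (simp add: inj_on_eq_iff)
  qed
  moreover have "relabel A \<gamma> ` {..<card A} \<subseteq> {..<card A}"
    using relabel_conjugates(1)[OF assms] by auto
  ultimately show "bij_betw (relabel A \<gamma>) {..<card A} {..<card A}"
    by (simp add: bij_betw_def endo_inj_surj)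
qed (simp add: relabel_def)

text \<open>
  Since \<open>0\<close> is the least element of \<open>A\<close>, the enumeration of \<open>A\<close> sends \<open>0\<close> to \<open>0\<close> and \<open>i > 0\<close> to
  the element at position \<open>i - 1\<close> of \<open>A - {0}\<close>. The marked point \<open>0\<close> is thus respected, and the
  singletons are read in their natural order.
\<close>

lemma tr_perm_relabel_entry:
  assumes A: "finite A" "0 \<in> A" and \<gamma>: "\<gamma> permutes A" and n: "card A = Suc m"
  shows "tr_perm m (relabel A \<gamma>) (\<lambda>i. B (sorted_list_of_set (A - {0}) ! (i - 1))) $ l $ r =
    state_sum A \<gamma> (B(0 := matrix_unit r l))"
proof -
  let ?e = "(!) (sorted_list_of_set A)"
  have eq: "{0..m} = {..<card A}" using n by auto
  have "Min A = 0" using A by (meson Min_le le_zero_eq)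
  then have cons: "sorted_list_of_set A = 0 # sorted_list_of_set (A - {0})"
    using sorted_list_of_set_nonempty[of A] A by auto
  have "0 \<notin> set (sorted_list_of_set (A - {0}))" using A by simp
  moreover have "length (sorted_list_of_set (A - {0})) = m" using A n by simp
  ultimately have pos: "sorted_list_of_set (A - {0}) ! (i - 1) \<noteq> 0" if "i \<noteq> 0" "i \<le> m" for i
    using that by (metis One_nat_def Suc_pred le_simps(3) not_gr_zero nth_mem)
  have "state_sum A \<gamma> (B(0 := matrix_unit r l)) =
      state_sum {0..m} (relabel A \<gamma>) (B(0 := matrix_unit r l) \<circ> ?e)"
    unfolding eq using relabel_conjugates[OF A(1) \<gamma>] bij_betw_sorted_list_of_set[OF A(1)]
    by (intro state_sum_reindex) auto
  also have "\<dots> = state_sum {0..m} (relabel A \<gamma>)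
      ((\<lambda>i. B (sorted_list_of_set (A - {0}) ! (i - 1)))(0 := matrix_unit r l))"
    using pos by (intro state_sum_cong) (auto simp: cons nth_Cons' simp del: neq0_conv)
  also have "\<dots> = tr_perm m (relabel A \<gamma>) (\<lambda>i. B (sorted_list_of_set (A - {0}) ! (i - 1))) $ l $ r"
    using relabel_permutes[OF A(1) \<gamma>] by (intro tr_perm_entry[symmetric]) (simp add: eq)
  finally show ?thesis by simp
qed

section \<open>Pairs and their involution\<close>

lemma partitions12_pairs:
  assumes "\<pi> \<in> partitions12 n"
  shows "finite (pairs \<pi>)"
    and "disjoint (pairs \<pi>)"
    and "pair_supp \<pi> \<subseteq> {1..n}"
    and "card (pair_supp \<pi>) = 2 * card (pairs \<pi>)"
proof -
  have part: "partition_on {1..n} \<pi>" using assms by (simp add: partitions12_def)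
  show "finite (pairs \<pi>)" using finite_elements[OF _ part] by (simp add: pairs_def)
  show dis: "disjoint (pairs \<pi>)"
    using partition_onD2[OF part] by (rule pairwise_subset) (auto simp: pairs_def)
  show "pair_supp \<pi> \<subseteq> {1..n}" using partition_onD1[OF part] by (auto simp: pair_supp_def pairs_def)
  have "card (pair_supp \<pi>) = (\<Sum>B\<in>pairs \<pi>. card B)"
    unfolding pair_supp_def using dis
    by (intro card_Union_disjoint) (auto simp: pairs_def intro: card_ge_0_finite)
  also have "\<dots> = (\<Sum>B\<in>pairs \<pi>. 2)" by (rule sum.cong) (auto simp: pairs_def)
  finally show "card (pair_supp \<pi>) = 2 * card (pairs \<pi>)" by simp
qed

lemma pairs_Min_Max:
  assumes "B \<in> pairs \<pi>"
  shows "B = {Min B, Max B}" "Min B \<noteq> Max B"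
proof -
  obtain i j where B: "B = {i, j}" "i \<noteq> j" using assms by (auto simp: pairs_def card_2_iff)
  then show "B = {Min B, Max B}" "Min B \<noteq> Max B" by (auto simp: min_def max_def)
qed

lemma involution_pair:
  assumes "\<pi> \<in> partitions12 n" "{i, j} \<in> pairs \<pi>" "i \<noteq> j"
  shows "involution \<pi> i = j"
proof -
  have part: "partition_on {1..n} \<pi>" using assms by (simp add: partitions12_def)
  have ij: "{i, j} \<in> \<pi>" using assms by (simp add: pairs_def)
  have "y = j" if "y \<noteq> i" "{i, y} \<in> \<pi>" for y
    using partition_onD2[OF part] ij that assms(3)
    by (metis disjointD doubleton_eq_iff insert_disjoint(1) insertI1)
  then have "(THE y. y \<noteq> i \<and> {i, y} \<in> \<pi>) = j" using ij assms(3) by (intro the_equality) auto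
  moreover have "i \<in> pair_supp \<pi>" using assms by (auto simp: pair_supp_def)
  ultimately show ?thesis by (simp add: involution_def)
qed

lemma involution_outside [simp]: "i \<notin> pair_supp \<pi> \<Longrightarrow> involution \<pi> i = i"
  by (simp add: involution_def)

lemma involution_partner:
  assumes "\<pi> \<in> partitions12 n" "i \<in> pair_supp \<pi>"
  shows "{i, involution \<pi> i} \<in> pairs \<pi>" "involution \<pi> (involution \<pi> i) = i" "involution \<pi> i \<in> pair_supp \<pi>"
proof -
  obtain B where B: "B \<in> pairs \<pi>" "i \<in> B" using assms by (auto simp: pair_supp_def)
  obtain x y where xy: "B = {x, y}" "x \<noteq> y" using B(1) by (auto simp: pairs_def card_2_iff)
  then obtain j where j: "B = {i, j}" "i \<noteq> j" using B(2) by (metis insertE insert_commute singletonD)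
  have "involution \<pi> i = j" using involution_pair[OF assms(1)] B j by blast
  moreover have "involution \<pi> j = i" using involution_pair[OF assms(1), of j i] B j by (auto simp: insert_commute)
  ultimately show "{i, involution \<pi> i} \<in> pairs \<pi>" "involution \<pi> (involution \<pi> i) = i"
    "involution \<pi> i \<in> pair_supp \<pi>" using B j by (auto simp: pair_supp_def)
qed

lemma involution_involution:
  assumes "\<pi> \<in> partitions12 n"
  shows "involution \<pi> (involution \<pi> i) = i"
  using involution_partner(2)[OF assms] by (cases "i \<in> pair_supp \<pi>") auto

lemma involution_permutes:
  assumes "\<pi> \<in> partitions12 n"
  shows "involution \<pi> permutes {0..n}"
proof (rule bij_imp_permutes)
  have "involution \<pi> i \<in> {0..n}" if "i \<in> {0..n}" for i
    using involution_partner(3)[OF assms, of i] partitions12_pairs(3)[OF assms] that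
    by (cases "i \<in> pair_supp \<pi>") auto
  then show "bij_betw (involution \<pi>) {0..n} {0..n}"
    by (intro bij_betwI[where g = "involution \<pi>"]) (auto simp: involution_involution[OF assms])
qed (use partitions12_pairs(3)[OF assms] in \<open>auto intro!: involution_outside\<close>)

lemma ball_pairs_iff:
  assumes "\<pi> \<in> partitions12 n"
  shows "(\<forall>B\<in>pairs \<pi>. P (Min B) (Max B) \<and> P (Max B) (Min B)) \<longleftrightarrow>
    (\<forall>i\<in>pair_supp \<pi>. P i (involution \<pi> i))"
proof (intro iffI ballI)
  fix i assume P: "\<forall>B\<in>pairs \<pi>. P (Min B) (Max B) \<and> P (Max B) (Min B)" and i: "i \<in> pair_supp \<pi>"
  note B = involution_partner(1)[OF assms i]
  show "P i (involution \<pi> i)"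
    using pairs_Min_Max[OF B] bspec[OF P B] by (metis doubleton_eq_iff)
next
  fix B assume P: "\<forall>i\<in>pair_supp \<pi>. P i (involution \<pi> i)" and B: "B \<in> pairs \<pi>"
  have "{Min B, Max B} \<in> pairs \<pi>" "{Max B, Min B} \<in> pairs \<pi>"
    using pairs_Min_Max[OF B] B by (simp_all add: insert_commute)
  moreover have "Min B \<in> pair_supp \<pi>" "Max B \<in> pair_supp \<pi>"
    using pairs_Min_Max[OF B] B unfolding pair_supp_def by blast+
  ultimately show "P (Min B) (Max B) \<and> P (Max B) (Min B)"
    using P involution_pair[OF assms] pairs_Min_Max(2)[OF B] by metis
qed

section \<open>Comparison of the two expansions\<close>

lemma mtensor_inner_matrix_unit:
  "mtensor_inner (elem_tensor (matrix_unit a b :: complex^'n::finite^'n) f)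
     (mtensor_conj (elem_tensor (matrix_unit c d) g)) =
   (if b = c \<and> a = d then complex_of_real (f \<bullet> g) / of_nat CARD('n) else 0)"
proof -
  have "mat_adjoint (mat_adjoint M) = M" for M :: "complex^'n^'n"
    by (simp add: mat_adjoint_def vec_eq_iff)
  then show ?thesis
    by (simp add: mtensor_conj_elem_tensor mtensor_inner_elem_tensor trace_matrix_unit_mult)
       (auto simp: matrix_unit_def)
qed

lemma prod_if_zero:
  fixes f :: "'a \<Rightarrow> 'b::{semidom}"
  assumes "finite I"
  shows "(\<Prod>i\<in>I. if P i then f i else 0) = (if \<forall>i\<in>I. P i then \<Prod>i\<in>I. f i else 0)"
proof (cases "\<forall>i\<in>I. P i")
  case False
  then show ?thesis using assms by (auto intro: prod_zero)
qed simp

text \<open>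
  The covariances of the matrix units turn the pairs of \<open>\<pi>\<close> into the condition
  \<open>u (\<alpha> i) = u (involution \<pi> i)\<close> on all paired \<open>i\<close>, with a factor \<open>1 / N\<close> for each pair. The condition
  says that \<open>u\<close> is locally constant along \<open>\<alpha> \<circ> involution \<pi>\<close>; the substitution of
  \<open>u \<circ> involution \<pi>\<close> for \<open>u\<close> makes it local constancy along \<open>\<beta>\<close>, the permutation used by the
  contraction, and does not change the labels of singletons.
\<close>

lemma wick_term_sum:
  fixes X :: "('h::real_inner, 'n::finite) mtensor \<Rightarrow> 'w \<Rightarrow> complex" and h :: "nat \<Rightarrow> 'h"
  assumes \<pi>: "\<pi> \<in> partitions12 n" and \<alpha>: "\<alpha> permutes {0..n}"
  defines "S \<equiv> pair_supp \<pi>" and "\<beta> \<equiv> involution \<pi> \<circ> \<alpha>"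
    and "k \<equiv> \<lambda>u i. elem_tensor (matrix_unit (u i) (u (\<alpha> i))) (h i)"
  shows "(\<Sum>u | u \<in> {0..n} \<rightarrow>\<^sub>E (UNIV :: 'n set) \<and> u 0 = r \<and> u (\<alpha> 0) = l.
      (\<Prod>B\<in>pairs \<pi>. mtensor_inner (k u (Min B)) (mtensor_conj (k u (Max B)))) *
      (\<Prod>m\<in>{1..n} - S. X (k u m) \<omega>)) =
    (\<Prod>B\<in>pairs \<pi>. complex_of_real (h (Min B) \<bullet> h (Max B))) / of_nat CARD('n) ^ card (pairs \<pi>) *
    of_nat CARD('n) ^ card (inner_cycles {0..n} \<beta> S) *
    state_sum ({0..n} - S) (skip_perm \<beta> S)
      ((\<lambda>i. gaussian_matrix X (h i) \<omega>)(0 := matrix_unit r l))"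
proof -
  let ?\<iota> = "involution \<pi>"
  let ?G = "(\<lambda>i. gaussian_matrix X (h i) \<omega>)(0 := matrix_unit r l)"
  let ?K = "(\<Prod>B\<in>pairs \<pi>. complex_of_real (h (Min B) \<bullet> h (Max B))) / of_nat CARD('n) ^ card (pairs \<pi>)"
  have S: "S \<subseteq> {1..n}" using partitions12_pairs(3)[OF \<pi>] by (simp add: S_def)
  have \<beta>: "\<beta> permutes {0..n}"
    unfolding \<beta>_def by (rule permutes_compose[OF \<alpha> involution_permutes[OF \<pi>]])
  have fin: "finite ({0..n} \<rightarrow>\<^sub>E (UNIV :: 'n set))" by (intro finite_PiE) auto
  have inA: "\<alpha> i \<in> {0..n}" "?\<iota> i \<in> {0..n}" "\<beta> i \<in> {0..n}" if "i \<in> {0..n}" for i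
    using that permutes_in_image[OF \<alpha>] permutes_in_image[OF \<beta>]
      permutes_in_image[OF involution_permutes[OF \<pi>]] by blast+
  have invS: "?\<iota> i \<in> S" if "i \<in> S" for i using involution_partner(3)[OF \<pi>] that by (simp add: S_def)
  have outS: "?\<iota> i = i" if "i \<notin> S" for i using that by (simp add: S_def)
  have pairs: "(\<Prod>B\<in>pairs \<pi>. mtensor_inner (k u (Min B)) (mtensor_conj (k u (Max B)))) =
      (if \<forall>i\<in>S. u (\<alpha> i) = u (?\<iota> i) then ?K else 0)" for u
  proof -
    have "(\<Prod>B\<in>pairs \<pi>. mtensor_inner (k u (Min B)) (mtensor_conj (k u (Max B)))) =
        (\<Prod>B\<in>pairs \<pi>. if u (\<alpha> (Min B)) = u (Max B) \<and> u (\<alpha> (Max B)) = u (Min B)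
           then complex_of_real (h (Min B) \<bullet> h (Max B)) / of_nat CARD('n) else 0)"
      by (intro prod.cong) (auto simp: k_def mtensor_inner_matrix_unit)
    also have "\<dots> = (if \<forall>B\<in>pairs \<pi>. u (\<alpha> (Min B)) = u (Max B) \<and> u (\<alpha> (Max B)) = u (Min B)
        then ?K else 0)"
      by (simp add: prod_if_zero partitions12_pairs(1)[OF \<pi>] prod_dividef)
    finally show ?thesis
      using ball_pairs_iff[OF \<pi>, of "\<lambda>i j. u (\<alpha> i) = u j"] by (simp add: S_def)
  qed
  have singles: "(\<Prod>i\<in>{0..n} - S. ?G i $ u i $ u (\<alpha> i)) =
      (if u 0 = r \<and> u (\<alpha> 0) = l then \<Prod>m\<in>{1..n} - S. X (k u m) \<omega> else 0)" for u
  proof -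
    have "{0..n} - S = insert 0 ({1..n} - S)" using S by auto
    then have "(\<Prod>i\<in>{0..n} - S. ?G i $ u i $ u (\<alpha> i)) =
        matrix_unit r l $ u 0 $ u (\<alpha> 0) * (\<Prod>i\<in>{1..n} - S. ?G i $ u i $ u (\<alpha> i))" by simp
    also have "(\<Prod>i\<in>{1..n} - S. ?G i $ u i $ u (\<alpha> i)) = (\<Prod>m\<in>{1..n} - S. X (k u m) \<omega>)"
      by (intro prod.cong) (auto simp: gaussian_matrix_def k_def)
    finally show ?thesis by (auto simp: matrix_unit_def)
  qed
  have "(\<Sum>u | u \<in> {0..n} \<rightarrow>\<^sub>E (UNIV :: 'n set) \<and> u 0 = r \<and> u (\<alpha> 0) = l.
      (\<Prod>B\<in>pairs \<pi>. mtensor_inner (k u (Min B)) (mtensor_conj (k u (Max B)))) *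
      (\<Prod>m\<in>{1..n} - S. X (k u m) \<omega>)) =
    (\<Sum>u\<in>{0..n} \<rightarrow>\<^sub>E (UNIV :: 'n set). if \<forall>i\<in>S. u (\<alpha> i) = u (?\<iota> i)
       then ?K * (\<Prod>i\<in>{0..n} - S. ?G i $ u i $ u (\<alpha> i)) else 0)"
    unfolding pairs singles using fin
    by (intro sum.mono_neutral_cong_left) auto
  also have "\<dots> = (\<Sum>u | u \<in> {0..n} \<rightarrow>\<^sub>E (UNIV :: 'n set) \<and> (\<forall>i\<in>S. u (\<alpha> i) = u (?\<iota> i)).
      ?K * (\<Prod>i\<in>{0..n} - S. ?G i $ u i $ u (\<alpha> i)))"
    using fin by (intro sum.mono_neutral_cong_right) auto
  also have "\<dots> = (\<Sum>u | u \<in> {0..n} \<rightarrow>\<^sub>E (UNIV :: 'n set) \<and> (\<forall>i\<in>S. u (\<beta> i) = u i).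
      ?K * (\<Prod>i\<in>{0..n} - S. ?G i $ u i $ u (\<beta> i)))"
  proof (rule sum.reindex_bij_witness[where
        i = "\<lambda>u. restrict (u \<circ> ?\<iota>) {0..n}" and j = "\<lambda>u. restrict (u \<circ> ?\<iota>) {0..n}"])
    fix u assume u: "u \<in> {u \<in> {0..n} \<rightarrow>\<^sub>E (UNIV :: 'n set). \<forall>i\<in>S. u (\<alpha> i) = u (?\<iota> i)}"
    let ?v = "restrict (u \<circ> ?\<iota>) {0..n}"
    have v: "?v (\<beta> i) = u (\<alpha> i)" "?v i = u (?\<iota> i)" if "i \<in> {0..n}" for i
      using inA(3)[OF that] that by (simp_all add: \<beta>_def involution_involution[OF \<pi>])
    show "restrict (?v \<circ> ?\<iota>) {0..n} = u"
      using u inA(2) involution_involution[OF \<pi>]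
      by (auto simp: fun_eq_iff PiE_def extensional_def)
    show "?v \<in> {u \<in> {0..n} \<rightarrow>\<^sub>E (UNIV :: 'n set). \<forall>i\<in>S. u (\<beta> i) = u i}"
      using u S v by auto
    show "?K * (\<Prod>i\<in>{0..n} - S. ?G i $ ?v i $ ?v (\<beta> i)) =
        ?K * (\<Prod>i\<in>{0..n} - S. ?G i $ u i $ u (\<alpha> i))"
      by (intro arg_cong[where f = "(*) ?K"] prod.cong refl)
         (elim DiffE, simp only: v outS not_False_eq_True)
  next
    fix u assume u: "u \<in> {u \<in> {0..n} \<rightarrow>\<^sub>E (UNIV :: 'n set). \<forall>i\<in>S. u (\<beta> i) = u i}"
    let ?v = "restrict (u \<circ> ?\<iota>) {0..n}"
    have v: "?v (\<alpha> i) = u (\<beta> i)" "?v (?\<iota> i) = u i" if "i \<in> {0..n}" for i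
      using inA[OF that] by (simp_all add: \<beta>_def involution_involution[OF \<pi>])
    show "restrict (?v \<circ> ?\<iota>) {0..n} = u"
      using u inA(2) involution_involution[OF \<pi>]
      by (auto simp: fun_eq_iff PiE_def extensional_def)
    have "?v (\<alpha> i) = ?v (?\<iota> i)" if "i \<in> S" for i
    proof -
      have "i \<in> {0..n}" using that S by auto
      then show ?thesis using u that by (simp only: v) simp
    qed
    moreover have "?v \<in> {0..n} \<rightarrow>\<^sub>E (UNIV :: 'n set)" by simp
    ultimately show "?v \<in> {u \<in> {0..n} \<rightarrow>\<^sub>E (UNIV :: 'n set). \<forall>i\<in>S. u (\<alpha> i) = u (?\<iota> i)}"
      by blast
  qed
  also have "\<dots> = ?K * (of_nat CARD('n) ^ card (inner_cycles {0..n} \<beta> S) *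
      state_sum ({0..n} - S) (skip_perm \<beta> S) ?G)"
    using S by (subst sum_distrib_left[symmetric], subst state_sum_skip_perm[OF \<beta>]) auto
  finally show ?thesis by (simp add: mult.assoc)
qed

text \<open>
  By \<open>cyc0_skip_perm\<close> the exponent of \<open>q = 1 / N\<close> is the number of pairs minus the number of
  cycles of \<open>\<beta>\<close> that consist of paired points only: the same weight as in \<open>wick_term_sum\<close>.
\<close>

lemma contraction_entry:
  fixes X :: "('h::real_inner, 'n::finite) mtensor \<Rightarrow> 'w \<Rightarrow> complex" and h :: "nat \<Rightarrow> 'h"
  assumes \<pi>: "\<pi> \<in> partitions12 n" and \<alpha>: "\<alpha> permutes {0..n}"
  defines "S \<equiv> pair_supp \<pi>" and "\<beta> \<equiv> involution \<pi> \<circ> \<alpha>"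
  shows "tr_alg (n - 2 * card (pairs \<pi>)) (contraction (1 / of_nat CARD('n)) n \<pi> \<alpha>)
      (\<lambda>i. gaussian_matrix X (h (sorted_list_of_set ({1..n} - S) ! (i - 1))) \<omega>) $ l $ r =
    of_nat CARD('n) ^ card (inner_cycles {0..n} \<beta> S) / of_nat CARD('n) ^ card (pairs \<pi>) *
    state_sum ({0..n} - S) (skip_perm \<beta> S)
      ((\<lambda>i. gaussian_matrix X (h i) \<omega>)(0 := matrix_unit r l))"
proof -
  let ?q = "1 / of_nat CARD('n) :: complex"
  let ?A = "{0..n} - S" and ?\<gamma> = "skip_perm \<beta> S" and ?p = "card (pairs \<pi>)"
  have S: "S \<subseteq> {1..n}" using partitions12_pairs(3)[OF \<pi>] by (simp add: S_def)
  have \<beta>: "\<beta> permutes {0..n}"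
    unfolding \<beta>_def by (rule permutes_compose[OF \<alpha> involution_permutes[OF \<pi>]])
  have \<gamma>: "?\<gamma> permutes ?A" by (rule skip_perm_permutes[OF \<beta>]) simp
  have "card S \<le> card {1..n}" using S by (intro card_mono) auto
  then have "card ?A = Suc (n - 2 * ?p)"
    using S partitions12_pairs(4)[OF \<pi>] finite_subset[OF S]
    by (subst card_Diff_subset) (auto simp: S_def)
  moreover have "?A - {0} = {1..n} - S" by auto
  moreover have "0 \<in> ?A" using S by auto
  ultimately have entry: "tr_perm (n - 2 * ?p) (relabel ?A ?\<gamma>)
      (\<lambda>i. gaussian_matrix X (h (sorted_list_of_set ({1..n} - S) ! (i - 1))) \<omega>) $ l $ r =
    state_sum ?A ?\<gamma> ((\<lambda>i. gaussian_matrix X (h i) \<omega>)(0 := matrix_unit r l))"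
    using tr_perm_relabel_entry[OF _ _ \<gamma>, of "n - 2 * ?p" "\<lambda>i. gaussian_matrix X (h i) \<omega>" l r] by simp
  have cyc: "cyc0 {0..n} \<beta> = card (inner_cycles {0..n} \<beta> S) + cyc0 ?A ?\<gamma>"
    using S by (intro cyc0_skip_perm[OF \<beta>]) auto
  have "?q powi (int (cyc0 ?A ?\<gamma>) - int (cyc0 {0..n} \<beta>) + int ?p) =
      ?q powi (int ?p - int (card (inner_cycles {0..n} \<beta> S)))" by (simp add: cyc)
  also have "\<dots> = of_nat CARD('n) ^ card (inner_cycles {0..n} \<beta> S) / of_nat CARD('n) ^ ?p"
    by (subst power_int_diff) (simp_all add: power_one_over)
  finally show ?thesis
    by (simp add: tr_alg_def contraction_def Let_def mat_scale_def entry
        flip: S_def \<beta>_def del: One_nat_def)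
qed

theorem mainTheorem13:
  fixes M :: "'w measure"
    and X :: "('h::{real_inner,complete_space}, 'n::finite) mtensor \<Rightarrow> 'w \<Rightarrow> complex"
    and h :: "nat \<Rightarrow> 'h"
    and \<alpha> :: "nat \<Rightarrow> nat"
    and n :: nat
    and l r :: 'n
  assumes "complexified_gaussian M X"
    and "\<alpha> permutes {0..n}"
  shows "\<forall>\<omega>\<in>space M.
    hermite_trace X n \<alpha> h \<omega> $ l $ r =
      (\<Sum>u | u \<in> {0..n} \<rightarrow>\<^sub>E (UNIV :: 'n set) \<and> u 0 = r \<and> u (\<alpha> 0) = l.
         wick X n (\<lambda>i. elem_tensor (matrix_unit (u i) (u (\<alpha> i))) (h i)) \<omega>)"
proof
  fix \<omega>
  let ?U = "{u \<in> {0..n} \<rightarrow>\<^sub>E (UNIV :: 'n set). u 0 = r \<and> u (\<alpha> 0) = l}"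
  let ?k = "\<lambda>u i. elem_tensor (matrix_unit (u i) (u (\<alpha> i))) (h i)"
  let ?T = "\<lambda>u \<pi>. (\<Prod>B\<in>pairs \<pi>. mtensor_inner (?k u (Min B)) (mtensor_conj (?k u (Max B)))) *
      (\<Prod>m\<in>{1..n} - pair_supp \<pi>. X (?k u m) \<omega>)"
  have "hermite_trace X n \<alpha> h \<omega> $ l $ r =
      (\<Sum>\<pi>\<in>partitions12 n. (- 1) ^ card (pairs \<pi>) * (\<Sum>u\<in>?U. ?T u \<pi>))"
    unfolding hermite_trace_def sum_component
    by (intro sum.cong refl)
       (simp add: mat_scale_def contraction_entry[OF _ assms(2)] wick_term_sum[OF _ assms(2)]
          del: One_nat_def)
  also have "\<dots> = (\<Sum>u\<in>?U. \<Sum>\<pi>\<in>partitions12 n. (- 1) ^ card (pairs \<pi>) * ?T u \<pi>)"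
    by (simp add: sum_distrib_left sum.swap[of _ _ ?U])
  also have "\<dots> = (\<Sum>u\<in>?U. wick X n (?k u) \<omega>)"
    by (simp add: wick_def mult.assoc)
  finally show "hermite_trace X n \<alpha> h \<omega> $ l $ r = (\<Sum>u\<in>?U. wick X n (?k u) \<omega>)" .
qed

end
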